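(* Let $(X,d)$ be a complete metric space, let $C\subseteq X$ be nonempty and closed, and let $T\colon C\to C$. Let $\omega(\cdot;\theta)$ be a contractive gauge, let $R>0$, and let $x_0\in C$ satisfy $C\subseteq\{y\in X: d(x_0,y)\le R\}$. Assume that $T$ is either a two-point gauge contraction on $C$ or a Proinov-type gauge contraction on $C$, with gauge $\omega(\cdot;\theta)$, and that $$\kappa:=\sup_{0<r\le R}\frac{\omega(r;\theta)}{r}<1 .$$ Let $x_{n+1}:=Tx_n$ for $n\in\mathbb N$, let $x^\ast$ be the unique fixed point of $T$ in $C$, and let $\delta_0:=d(x_1,x_0)=d(Tx_0,x_0)$. Then for every $n\in\mathbb N$, $$d(x_n,x^\ast)\le\frac{\kappa^{n}}{1-\kappa}\,\delta_0\qquad\text{and}\qquad d(x_n,Tx_n)=d(x_n,x_{n+1})\le\kappa^{n}\,\delta_0 .$$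
   Context: $\mathbb N=\{0,1,2,\dots\}$. A contractive gauge is a map $\omega(\cdot;\theta)\colon[0,\infty)\to[0,\infty)$, depending on a finite parameter vector $\theta$, such that $\omega(0;\theta)=0$, $\omega(\cdot;\theta)$ is nondecreasing, and $\omega(r;\theta)<r$ for every $r>0$. $T\colon C\to C$ is a two-point gauge contraction on $C$ with gauge $\omega(\cdot;\theta)$ if $d(Tx,Ty)\le\omega(d(x,y);\theta)$ for all $x,y\in C$. $T\colon C\to C$ is a Proinov-type gauge contraction on $C$ with gauge $\omega(\cdot;\theta)$ if $d(Tx,Ty)\le\omega(M_T(x,y);\theta)$ for all $x,y\in C$, where $$M_T(x,y):=\max\Bigl\{d(x,y),\ d(x,Tx),\ d(y,Ty),\ \tfrac12\bigl(d(x,Ty)+d(y,Tx)\bigr)\Bigr\}.$$ Under the hypotheses of the claim, $T$ has exactly one fixed point in $C$. *)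

theory Defs
  imports "HOL-Analysis.Analysis"
begin

text \<open>Gauges map the nonnegative reals to themselves; as HOL functions are total, their values
  at negative arguments are left unconstrained.\<close>

definition contractive_gauge :: "(real \<Rightarrow> real) \<Rightarrow> bool" where
  "contractive_gauge g \<longleftrightarrow>
     g \<in> {0..} \<rightarrow> {0..} \<and> g 0 = 0 \<and> mono_on {0..} g \<and> (\<forall>r>0. g r < r)"

definition two_point_gauge_contraction ::
    "'a::metric_space set \<Rightarrow> ('a \<Rightarrow> 'a) \<Rightarrow> (real \<Rightarrow> real) \<Rightarrow> bool" where
  "two_point_gauge_contraction C T g \<longleftrightarrow>
     T \<in> C \<rightarrow> C \<and> (\<forall>x\<in>C. \<forall>y\<in>C. dist (T x) (T y) \<le> g (dist x y))"

definition proinov_max :: "('a::metric_space \<Rightarrow> 'a) \<Rightarrow> 'a \<Rightarrow> 'a \<Rightarrow> real" where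
  "proinov_max T x y =
     Max {dist x y, dist x (T x), dist y (T y), 1/2 * (dist x (T y) + dist y (T x))}"

definition proinov_gauge_contraction ::
    "'a::metric_space set \<Rightarrow> ('a \<Rightarrow> 'a) \<Rightarrow> (real \<Rightarrow> real) \<Rightarrow> bool" where
  "proinov_gauge_contraction C T g \<longleftrightarrow>
     T \<in> C \<rightarrow> C \<and> (\<forall>x\<in>C. \<forall>y\<in>C. dist (T x) (T y) \<le> g (proinov_max T x y))"

end

theory Submission
  imports Defs
begin

text \<open>By monotonicity of the gauge a two-point contraction is a Proinov-type one. Along an orbit
  the Proinov maximum collapses to the larger of two consecutive steps, and since \<open>\<omega> r < r\<close> it must
  be the earlier one. Hence the steps decrease, and as the first step is at most \<open>R\<close> they shrink
  by the factor \<open>\<kappa>\<close>, so the orbit is Cauchy with geometric tails. Points of \<open>C\<close> may be up to \<open>2R\<close>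
  apart, so \<open>\<kappa>\<close> does not control all distances in \<open>C\<close>; that the limit is a fixed point, and the
  only one, is derived from \<open>\<omega> r < r\<close> alone.\<close>

lemma contractive_gauge_nonneg: "contractive_gauge g \<Longrightarrow> 0 \<le> r \<Longrightarrow> 0 \<le> g r"
  unfolding contractive_gauge_def by auto

lemma contractive_gauge_mono:
  "contractive_gauge g \<Longrightarrow> 0 \<le> r \<Longrightarrow> r \<le> s \<Longrightarrow> g r \<le> g s"
  unfolding contractive_gauge_def by (auto intro: mono_onD[of "{0..}" g])

lemma contractive_gauge_less: "contractive_gauge g \<Longrightarrow> 0 < r \<Longrightarrow> g r < r"
  unfolding contractive_gauge_def by auto

text \<open>Since \<open>g r < r\<close>, all quotients are bounded by 1. This makes the real-valued
  \<open>SUP\<close> a genuine least upper bound.\<close>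

lemma contractive_gauge_quotient:
  assumes "contractive_gauge g" "0 < r" "r \<le> R"
  shows "g r / r \<le> (SUP r\<in>{0<..R}. g r / r)"
proof (rule cSUP_upper)
  show "bdd_above ((\<lambda>r. g r / r) ` {0<..R})"
  proof (rule bdd_aboveI2)
    show "g r / r \<le> 1" if "r \<in> {0<..R}" for r
      using that contractive_gauge_less[OF assms(1), of r] by simp
  qed
qed (use assms in auto)

lemma contractive_gauge_SUP_nonneg:
  assumes "contractive_gauge g" "0 < R"
  shows "0 \<le> (SUP r\<in>{0<..R}. g r / r)"
proof -
  have "0 \<le> g R / R"
    using contractive_gauge_nonneg[OF assms(1), of R] assms(2) by simp
  also have "\<dots> \<le> (SUP r\<in>{0<..R}. g r / r)"
    using contractive_gauge_quotient[OF assms] by simp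
  finally show ?thesis .
qed

text \<open>The supremum ranges over \<open>0 < r \<le> R\<close> only: \<open>r = 0\<close> is
  covered by \<open>g 0 = 0\<close>, and any use of the bound has to establish
  \<open>r \<le> R\<close> first.\<close>

lemma contractive_gauge_le_SUP_mult:
  assumes "contractive_gauge g" "0 \<le> r" "r \<le> R"
  shows "g r \<le> (SUP r\<in>{0<..R}. g r / r) * r"
proof (cases "r = 0")
  case True
  then show ?thesis
    using assms(1) by (simp add: contractive_gauge_def)
next
  case False
  then show ?thesis
    using contractive_gauge_quotient[OF assms(1) _ assms(3)] assms(2) by (simp add: pos_divide_le_eq)
qed

lemma two_point_imp_proinov_gauge_contraction:
  assumes g: "contractive_gauge g" and "two_point_gauge_contraction C T g"
  shows "proinov_gauge_contraction C T g"
proof -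
  have "g (dist x y) \<le> g (proinov_max T x y)" for x y
    by (rule contractive_gauge_mono[OF g]) (auto simp: proinov_max_def)
  with assms(2) show ?thesis
    unfolding two_point_gauge_contraction_def proinov_gauge_contraction_def
    by (meson order_trans)
qed

lemma proinov_gauge_contraction_step:
  assumes g: "contractive_gauge g" and T: "proinov_gauge_contraction C T g" and "x \<in> C"
  shows "dist (T x) (T (T x)) \<le> g (dist x (T x))"
proof -
  let ?a = "dist x (T x)" and ?b = "dist (T x) (T (T x))"
  have "T x \<in> C"
    using T \<open>x \<in> C\<close> by (auto simp: proinov_gauge_contraction_def)
  then have le: "?b \<le> g (proinov_max T x (T x))"
    using T \<open>x \<in> C\<close> by (auto simp: proinov_gauge_contraction_def)
  \<comment> \<open>In the averaged entry \<open>dist (T x) (T x)\<close> vanishes. What remains is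
    half of \<open>dist x (T (T x))\<close>, at most the mean of \<open>?a\<close> and
    \<open>?b\<close> and hence at most their maximum.\<close>
  have M: "proinov_max T x (T x) = max ?a ?b"
    using dist_triangle[of x "T (T x)" "T x"] by (auto simp: proinov_max_def max_def)
  show ?thesis
  proof (cases "?b \<le> ?a")
    case True
    then show ?thesis using le M by (simp add: max_absorb1)
  next
    \<comment> \<open>Here the maximum is \<open>?b\<close>, so \<open>le\<close> reads
      \<open>?b \<le> g ?b\<close>, which is impossible for positive \<open>?b\<close>.\<close>
    case False
    then have "0 < ?b" using zero_le_dist[of x "T x"] by linarith
    then have "g ?b < ?b" by (rule contractive_gauge_less[OF g])
    with False show ?thesis using le M by (simp add: max_absorb2)
  qed
qed

lemma proinov_gauge_contraction_fixpoint_unique: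
  assumes g: "contractive_gauge g" and T: "proinov_gauge_contraction C T g"
    and "p \<in> C" "T p = p" "q \<in> C" "T q = q"
  shows "p = q"
proof (rule ccontr)
  assume "p \<noteq> q"
  then have "g (dist p q) < dist p q"
    by (intro contractive_gauge_less[OF g]) simp
  moreover have "dist p q \<le> g (proinov_max T p q)"
    using T assms(3-) by (force simp: proinov_gauge_contraction_def)
  \<comment> \<open>At fixed points the two self-displacements vanish, and the averaged entry is
    \<open>dist p q\<close> by symmetry.\<close>
  moreover have "proinov_max T p q = dist p q"
    using assms(4,6) by (simp add: proinov_max_def dist_commute)
  ultimately show False by simp
qed

text \<open>If \<open>?D = dist p (T p)\<close> were positive, every other entry of
  \<open>proinov_max T (x n) p\<close> would eventually lie below \<open>?D\<close>. The gauge is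
  then evaluated at the constant \<open>?D\<close>, and letting \<open>n\<close> tend to infinity
  yields \<open>?D \<le> g ?D\<close>, a contradiction.\<close>

lemma proinov_gauge_contraction_orbit_limit_fixpoint:
  assumes g: "contractive_gauge g" and T: "proinov_gauge_contraction C T g"
    and x: "\<And>n. x n \<in> C" "\<And>n. x (Suc n) = T (x n)"
    and lim: "x \<longlonglongrightarrow> p" and "p \<in> C"
  shows "T p = p"
proof (rule ccontr)
  let ?D = "dist p (T p)"
  assume "T p \<noteq> p"
  then have D: "0 < ?D" by simp
  have lim': "(\<lambda>n. T (x n)) \<longlonglongrightarrow> p"
    using LIMSEQ_Suc[OF lim] by (simp add: x(2))
  have "(\<lambda>n. dist (x n) p) \<longlonglongrightarrow> dist p p"
    by (intro tendsto_intros lim)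
  then have near: "\<forall>\<^sub>F n in sequentially. dist (x n) p < ?D"
    by (rule order_tendstoD(2)) (use D in simp)
  have "(\<lambda>n. dist (x n) (T (x n))) \<longlonglongrightarrow> dist p p"
    by (intro tendsto_intros lim lim')
  then have step: "\<forall>\<^sub>F n in sequentially. dist (x n) (T (x n)) < ?D"
    by (rule order_tendstoD(2)) (use D in simp)
  \<comment> \<open>The averaged entry tends to \<open>?D / 2\<close>, which is below
    \<open>?D\<close>; without the factor 1/2 the limit would be \<open>?D\<close> itself.\<close>
  have "(\<lambda>n. 1/2 * (dist (x n) (T p) + dist p (T (x n)))) \<longlonglongrightarrow> 1/2 * (?D + dist p p)"
    by (intro tendsto_intros lim lim')
  then have "\<forall>\<^sub>F n in sequentially. 1/2 * (dist (x n) (T p) + dist p (T (x n))) < ?D"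
    by (rule order_tendstoD(2)) (use D in simp)
  with near step have "\<forall>\<^sub>F n in sequentially. dist (T (x n)) (T p) \<le> g ?D"
  proof eventually_elim
    case (elim n)
    then have "proinov_max T (x n) p = ?D"
      by (auto simp: proinov_max_def max_def)
    moreover have "dist (T (x n)) (T p) \<le> g (proinov_max T (x n) p)"
      using T x(1) \<open>p \<in> C\<close> by (auto simp: proinov_gauge_contraction_def)
    ultimately show ?case by simp
  qed
  then have "?D \<le> g ?D"
    by (rule tendsto_upperbound[OF tendsto_dist[OF lim' tendsto_const]]) simp
  with contractive_gauge_less[OF g D] show False by simp
qed

lemma dist_le_geometric_tail:
  fixes x :: "nat \<Rightarrow> 'a::metric_space"
  assumes k: "0 \<le> k" "k < 1" and "0 \<le> d"
    and step: "\<And>n. dist (x n) (x (Suc n)) \<le> k ^ n * d"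
  shows "dist (x n) (x (n + m)) \<le> k ^ n / (1 - k) * d"
proof -
  \<comment> \<open>The exact partial geometric sum is kept, because the bound of the lemma itself
    is too weak to carry an induction on \<open>m\<close>.\<close>
  have "dist (x n) (x (n + m)) \<le> k ^ n * (1 - k ^ m) / (1 - k) * d"
  proof (induction m)
    case (Suc m)
    have "dist (x n) (x (n + Suc m)) \<le> dist (x n) (x (n + m)) + dist (x (n + m)) (x (Suc (n + m)))"
      by (simp add: dist_triangle)
    also have "\<dots> \<le> k ^ n * (1 - k ^ m) / (1 - k) * d + k ^ (n + m) * d"
      using Suc step[of "n + m"] by linarith
    also have "\<dots> = k ^ n * (1 - k ^ Suc m) / (1 - k) * d"
      using k by (simp add: field_simps power_add)
    finally show ?case .
  qed simp
  also have "\<dots> \<le> k ^ n / (1 - k) * d"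
    using k \<open>0 \<le> d\<close>
    by (intro mult_right_mono divide_right_mono) (auto intro!: mult_left_le)
  finally show ?thesis .
qed

lemma Cauchy_if_geometric_steps:
  fixes x :: "nat \<Rightarrow> 'a::metric_space"
  assumes k: "0 \<le> k" "k < 1" and "0 \<le> d"
    and step: "\<And>n. dist (x n) (x (Suc n)) \<le> k ^ n * d"
  shows "Cauchy x"
proof (rule metric_CauchyI)
  fix e :: real
  assume "0 < e"
  have "(\<lambda>n. k ^ n / (1 - k) * d) \<longlonglongrightarrow> 0 / (1 - k) * d"
    using k by (intro tendsto_intros LIMSEQ_realpow_zero) auto
  \<comment> \<open>The threshold is \<open>e / 2\<close> because two late terms are compared
    through \<open>x N\<close>.\<close>
  then have "\<forall>\<^sub>F n in sequentially. k ^ n / (1 - k) * d < e / 2"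
    by (rule order_tendstoD(2)) (use \<open>0 < e\<close> in simp)
  then obtain N where N: "k ^ N / (1 - k) * d < e / 2"
    by (auto simp: eventually_sequentially)
  have near: "dist (x N) (x n) < e / 2" if "N \<le> n" for n
    using order.strict_trans1[OF dist_le_geometric_tail[OF assms, of N "n - N"] N] that by simp
  show "\<exists>M. \<forall>m\<ge>M. \<forall>n\<ge>M. dist (x m) (x n) < e"
    using near by (blast intro: dist_triangle_half_r)
qed

text \<open>The tail bound does not depend on \<open>m\<close>, so it survives the limit
  \<open>m\<close> to infinity.\<close>

lemma dist_limit_le_geometric:
  fixes x :: "nat \<Rightarrow> 'a::metric_space"
  assumes k: "0 \<le> k" "k < 1" and "0 \<le> d"
    and step: "\<And>n. dist (x n) (x (Suc n)) \<le> k ^ n * d"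
    and lim: "x \<longlonglongrightarrow> p"
  shows "dist (x n) p \<le> k ^ n / (1 - k) * d"
proof (rule tendsto_upperbound)
  show "(\<lambda>m. dist (x n) (x (n + m))) \<longlonglongrightarrow> dist (x n) p"
    using LIMSEQ_ignore_initial_segment[OF lim, of n]
    by (intro tendsto_dist tendsto_const) (simp add: add.commute)
  show "\<forall>\<^sub>F m in sequentially. dist (x n) (x (n + m)) \<le> k ^ n / (1 - k) * d"
    using dist_le_geometric_tail[OF k \<open>0 \<le> d\<close> step] by simp
qed simp

theorem theorem4p4:
  fixes C :: "'a::complete_space set" and T :: "'a \<Rightarrow> 'a"
    and \<omega> :: "'p list \<Rightarrow> real \<Rightarrow> real" and \<theta> :: "'p list"
    and R \<kappa> \<delta>\<^sub>0 :: real and x :: "nat \<Rightarrow> 'a" and x\<^sub>0 :: 'a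
  assumes "C \<noteq> {}" and "closed C" and "T \<in> C \<rightarrow> C"
    and "contractive_gauge (\<omega> \<theta>)"
    and "R > 0" and "x\<^sub>0 \<in> C" and "C \<subseteq> {y. dist x\<^sub>0 y \<le> R}"
    and "two_point_gauge_contraction C T (\<omega> \<theta>) \<or> proinov_gauge_contraction C T (\<omega> \<theta>)"
    and "\<kappa> = (SUP r\<in>{0<..R}. \<omega> \<theta> r / r)" and "\<kappa> < 1"
    and "x 0 = x\<^sub>0" and "\<And>n. x (Suc n) = T (x n)"
    and "\<delta>\<^sub>0 = dist (x 1) (x 0)"
  shows "(\<exists>!p. p \<in> C \<and> T p = p) \<and>
    (\<forall>p. p \<in> C \<and> T p = p \<longrightarrow>
      (\<forall>n. dist (x n) p \<le> \<kappa> ^ n / (1 - \<kappa>) * \<delta>\<^sub>0 \<and>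
           dist (x n) (T (x n)) = dist (x n) (x (Suc n)) \<and>
           dist (x n) (x (Suc n)) \<le> \<kappa> ^ n * \<delta>\<^sub>0))"
proof -
  note g = \<open>contractive_gauge (\<omega> \<theta>)\<close> and T_C = \<open>T \<in> C \<rightarrow> C\<close>
    and \<kappa>_def = \<open>\<kappa> = (SUP r\<in>{0<..R}. \<omega> \<theta> r / r)\<close> and x_Suc = \<open>\<And>n. x (Suc n) = T (x n)\<close>
  have T: "proinov_gauge_contraction C T (\<omega> \<theta>)"
    using assms(8) two_point_imp_proinov_gauge_contraction[OF g] by blast
  have \<kappa>: "0 \<le> \<kappa>" "\<kappa> < 1"
    using contractive_gauge_SUP_nonneg[OF g \<open>R > 0\<close>] \<kappa>_def \<open>\<kappa> < 1\<close> by auto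
  have x_C: "x n \<in> C" for n
    by (induction n) (use \<open>x 0 = x\<^sub>0\<close> \<open>x\<^sub>0 \<in> C\<close> x_Suc T_C in auto)
  \<comment> \<open>The orbit starts at the centre of the ball containing \<open>C\<close>, so the
    first step is at most the radius, not merely the diameter.\<close>
  have \<delta>: "0 \<le> \<delta>\<^sub>0" "\<delta>\<^sub>0 \<le> R"
    using assms(7,11,13) x_C[of 1] by (auto simp: dist_commute)
  have step: "dist (x n) (x (Suc n)) \<le> \<kappa> ^ n * \<delta>\<^sub>0" for n
  proof (induction n)
    case 0
    then show ?case using assms(13) by (simp add: dist_commute)
  next
    case (Suc n)
    \<comment> \<open>The induction hypothesis itself keeps the current step within
      \<open>R\<close>, where \<kappa> bounds the quotients of the gauge.\<close>
    have "\<kappa> ^ n * \<delta>\<^sub>0 \<le> 1 * R"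
      using \<kappa> \<delta> by (intro mult_mono power_le_one) auto
    then have "dist (x n) (x (Suc n)) \<le> R"
      using Suc by simp
    have "dist (x (Suc n)) (x (Suc (Suc n))) \<le> \<omega> \<theta> (dist (x n) (x (Suc n)))"
      using proinov_gauge_contraction_step[OF g T x_C[of n]] by (simp add: x_Suc)
    also have "\<dots> \<le> \<kappa> * dist (x n) (x (Suc n))"
      unfolding \<kappa>_def by (rule contractive_gauge_le_SUP_mult[OF g]) (simp, fact)
    also have "\<dots> \<le> \<kappa> ^ Suc n * \<delta>\<^sub>0"
      using mult_left_mono[OF Suc \<kappa>(1)] by (simp add: mult.assoc)
    finally show ?case .
  qed
  have "Cauchy x"
    by (rule Cauchy_if_geometric_steps[OF \<kappa> \<delta>(1) step])
  then obtain p where lim: "x \<longlonglongrightarrow> p"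
    by (auto simp: Cauchy_convergent_iff convergent_def)
  have "p \<in> C"
    using closed_sequentially[OF \<open>closed C\<close> x_C lim] .
  moreover have "T p = p"
    using proinov_gauge_contraction_orbit_limit_fixpoint[OF g T x_C x_Suc lim \<open>p \<in> C\<close>] .
  \<comment> \<open>Every fixed point in \<open>C\<close> is the orbit limit \<open>p\<close>, so
    the estimates proved for \<open>p\<close> apply to whichever fixed point the statement
    quantifies over.\<close>
  ultimately have fix_iff: "q \<in> C \<and> T q = q \<longleftrightarrow> q = p" for q
    using proinov_gauge_contraction_fixpoint_unique[OF g T] by blast
  show ?thesis
    using dist_limit_le_geometric[OF \<kappa> \<delta>(1) step lim] step by (simp add: fix_iff x_Suc)
qed

end
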